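(* There exists a topological dynamical system $(X,T)$ which is $\Delta^*$-mixing but not full-scattering.
   Context: A topological dynamical system $(X,T)$ consists of a compact metric space $X$ and a continuous surjection $T\colon X\to X$. Write $\mathbb{Z}_+=\{0,1,2,\ldots\}$. Full-scattering: for a finite cover $\mathcal{U}$ of $X$, $N(\mathcal{U})$ denotes the least cardinality of a subcover of $\mathcal{U}$. For covers $\mathcal{U}_1,\ldots,\mathcal{U}_n$ of $X$, the join $\bigvee_{i=1}^n\mathcal{U}_i$ is the cover consisting of all intersections $V_1\cap\cdots\cap V_n$ with $V_i\in\mathcal{U}_i$, and $T^{-a}\mathcal{U}=\{T^{-a}U:U\in\mathcal{U}\}$. For an infinite set $A=\{a_1<a_2<\cdots\}\subset\mathbb{Z}_+$ put $c_A(\mathcal{U},n)=N\left(\bigvee_{i=1}^nT^{-a_i}\mathcal{U}\right)$. A finite open cover $\mathcal{U}=\{U_1,\ldots,U_k\}$ of $X$ is non-trivial if no $U_i$ is dense in $X$. The system $(X,T)$ is full-scattering if $c_A(\mathcal{U},n)\to\infty$ as $n\to\infty$ for every infinite $A\subset\mathbb{Z}_+$ and every non-trivial finite open cover $\mathcal{U}$ of $X$. $\Delta^*$-mixing: let $\Delta$ be the family of all subsets of $\mathbb{Z}_+$ that contain all positive differences $\{d'-d:d,d'\in D,\ d<d'\}$ of some infinite set $D\subset\mathbb{Z}_+$. Let $\Delta^*$ be the dual family: $E\subset\mathbb{Z}_+$ belongs to $\Delta^*$ if and only if $E$ meets every member of $\Delta$. For nonempty open $U,V\subset X$ let $N(U,V)=\{n\in\mathbb{Z}_+:U\cap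 T^{-n}V\neq\varnothing\}$. A system is $\Delta^*$-transitive if $N(U,V)\in\Delta^*$ for all nonempty open $U,V$, and $(X,T)$ is $\Delta^*$-mixing if its Cartesian square $(X\times X,T\times T)$ is $\Delta^*$-transitive. *)

theory Defs
  imports "HOL-Analysis.Analysis"
begin

section \<open>Topological dynamical systems\<close>

text \<open>The carrier is required to be nonempty: on the empty space the empty family would count
  as a non-trivial open cover, and full-scattering would fail for degenerate reasons.

  Spaces are carrier sets with a metric, so that systems can be quantified inside a formula.
  Every compact metric space has at most the cardinality of the continuum, hence is isometric to
  some \<open>(M, d)\<close> with \<open>M\<close> a set of functions \<open>nat \<Rightarrow> real\<close> and \<open>d\<close> an arbitrary metric on it.\<close>

definition tds :: "'a set \<Rightarrow> ('a \<Rightarrow> 'a \<Rightarrow> real) \<Rightarrow> ('a \<Rightarrow> 'a) \<Rightarrow> bool" where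
  "tds M d T \<longleftrightarrow>
     Metric_space M d \<and> M \<noteq> {} \<and>
     compact_space (Metric_space.mtopology M d) \<and>
     continuous_map (Metric_space.mtopology M d) (Metric_space.mtopology M d) T \<and>
     T ` M = M"

text \<open>All further notions depend only on the topology. The map \<open>T\<close> matters only on
  \<open>topspace X\<close>, so preimages are taken inside the space.\<close>

definition iter_preimage :: "'a topology \<Rightarrow> ('a \<Rightarrow> 'a) \<Rightarrow> nat \<Rightarrow> 'a set \<Rightarrow> 'a set" where
  "iter_preimage X T n V = {x \<in> topspace X. (T ^^ n) x \<in> V}"

section \<open>Full-scattering\<close>

definition is_cover :: "'a set \<Rightarrow> 'a set set \<Rightarrow> bool" where
  "is_cover S \<U> \<longleftrightarrow> (\<forall>U\<in>\<U>. U \<subseteq> S) \<and> \<Union>\<U> = S"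

text \<open>Only used for finite covers; the explicit finiteness of the subcover is needed because
  \<open>card\<close> is \<open>0\<close> on infinite sets.\<close>

definition min_subcover_card :: "'a set \<Rightarrow> 'a set set \<Rightarrow> nat" where
  "min_subcover_card S \<U> =
     (LEAST k. \<exists>\<V>. \<V> \<subseteq> \<U> \<and> finite \<V> \<and> card \<V> = k \<and> is_cover S \<V>)"

text \<open>The join of \<open>\<U> 0, \<dots>, \<U> (n - 1)\<close>. Intersecting with \<open>S\<close> only affects the case \<open>n = 0\<close>,
  where the join is the one-element cover \<open>{S}\<close>.\<close>

definition cover_join :: "'a set \<Rightarrow> nat \<Rightarrow> (nat \<Rightarrow> 'a set set) \<Rightarrow> 'a set set" where
  "cover_join S n \<U> = {S \<inter> (\<Inter>i<n. V i) | V. \<forall>i<n. V i \<in> \<U> i}"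

text \<open>\<open>enumerate A\<close> lists an infinite \<open>A\<close> in increasing order starting at index \<open>0\<close>, so
  \<open>enumerate A i\<close> is the element usually written \<open>a\<close> with index \<open>i + 1\<close>.\<close>

definition cover_complexity ::
  "'a topology \<Rightarrow> ('a \<Rightarrow> 'a) \<Rightarrow> nat set \<Rightarrow> 'a set set \<Rightarrow> nat \<Rightarrow> nat" where
  "cover_complexity X T A \<U> n =
     min_subcover_card (topspace X)
       (cover_join (topspace X) n (\<lambda>i. iter_preimage X T (enumerate A i) ` \<U>))"

definition nontrivial_open_cover :: "'a topology \<Rightarrow> 'a set set \<Rightarrow> bool" where
  "nontrivial_open_cover X \<U> \<longleftrightarrow>
     finite \<U> \<and> (\<forall>U\<in>\<U>. openin X U) \<and> is_cover (topspace X) \<U> \<and>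
     (\<forall>U\<in>\<U>. X closure_of U \<noteq> topspace X)"

definition full_scattering :: "'a topology \<Rightarrow> ('a \<Rightarrow> 'a) \<Rightarrow> bool" where
  "full_scattering X T \<longleftrightarrow>
     (\<forall>A \<U>. infinite A \<and> nontrivial_open_cover X \<U> \<longrightarrow>
        filterlim (cover_complexity X T A \<U>) at_top sequentially)"

section \<open>Mixing along the dual of the family of difference sets\<close>

definition Delta_family :: "nat set set" where
  "Delta_family =
     {F. \<exists>D. infinite D \<and> {d' - d | d d'. d \<in> D \<and> d' \<in> D \<and> d < d'} \<subseteq> F}"

definition Delta_star :: "nat set set" where
  "Delta_star = {E. \<forall>F\<in>Delta_family. E \<inter> F \<noteq> {}}"

definition hitting_times :: "'a topology \<Rightarrow> ('a \<Rightarrow> 'a) \<Rightarrow> 'a set \<Rightarrow> 'a set \<Rightarrow> nat set" where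
  "hitting_times X T U V = {n. U \<inter> iter_preimage X T n V \<noteq> {}}"

definition Delta_star_transitive :: "'a topology \<Rightarrow> ('a \<Rightarrow> 'a) \<Rightarrow> bool" where
  "Delta_star_transitive X T \<longleftrightarrow>
     (\<forall>U V. openin X U \<and> U \<noteq> {} \<and> openin X V \<and> V \<noteq> {} \<longrightarrow>
        hitting_times X T U V \<in> Delta_star)"

definition Delta_star_mixing :: "'a topology \<Rightarrow> ('a \<Rightarrow> 'a) \<Rightarrow> bool" where
  "Delta_star_mixing X T \<longleftrightarrow> Delta_star_transitive (prod_topology X X) (map_prod T T)"

end

theory Submission
  imports Defs
begin

text \<open>
  The example is a one-sided subshift \<open>X\<close> on the symbols \<open>0, 1, 2, 3\<close>. Fix an infinite set \<open>A\<close> of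
  natural numbers whose gaps tend to infinity, such as the powers of two. A point \<open>x\<close> belongs to
  \<open>X\<close> if no integer translate of \<open>A\<close> meets all three of the sets where \<open>x\<close> takes the values
  \<open>1\<close>, \<open>2\<close> and \<open>3\<close>: the colours \<open>1, 2, 3\<close> never form a rainbow along a translate of \<open>A\<close>, while the
  symbol \<open>0\<close> is neutral. This condition is closed and shift-invariant, and prepending a \<open>0\<close> shows
  that the shift is onto.

  \<^emph>\<open>Not full-scattering.\<close> Cover \<open>X\<close> by \<open>U\<^sub>s = {x. x 0 \<noteq> s}\<close> for \<open>s = 1, 2, 3\<close>; none of these is dense.
  Along \<open>A\<close> itself every point misses some colour \<open>s\<close>, so it follows the constant itinerary \<open>U\<^sub>s\<close>
  at all times in \<open>A\<close>. Hence three elements of every join along \<open>A\<close> cover \<open>X\<close>, and the complexity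
  never exceeds \<open>3\<close> (lemma \<open>not_full_scattering_rainbow_free\<close>). Two colours would not do:
  forbidding pairs along \<open>A\<close> removes all differences of \<open>A\<close> from a set of hitting times, whereas
  forbidding triples leaves every pair of symbols possible at every distance.

  \<^emph>\<open>Mixing.\<close> To pass from a word of length \<open>L\<close> to another one in time \<open>n\<close>, write both words
  and fill the rest with \<open>0\<close>. A rainbow created by this must use two positions in one word and one
  in the other. The first two come from a pair of elements of \<open>A\<close> less than \<open>L\<close> apart, of which
  there are only finitely many; so, for large \<open>n\<close>, the third element of \<open>A\<close> lies within a constant
  of \<open>n\<close>. The
  gluing therefore succeeds for all large \<open>n\<close> that are farther from \<open>A\<close> than a constant depending
  only on \<open>L\<close> (lemma \<open>glue_in_rainbow_free\<close>). As only \<open>n\<close> matters, the same time serves for two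
  pairs of words at once. Finally, the differences of an infinite set \<open>D\<close> cannot all stay close to
  \<open>A\<close> (lemma \<open>difference_far_from_set_with_gaps\<close>): for fixed \<open>d0 < d1\<close> in \<open>D\<close> and \<open>e \<in> D\<close> tending to
  infinity, \<open>e - d0\<close> and \<open>e - d1\<close> would be near two elements of \<open>A\<close> at bounded positive distance.
\<close>

section \<open>Sets whose gaps tend to infinity\<close>

definition gaps_to_infinity :: "nat set \<Rightarrow> bool" where
  "gaps_to_infinity A \<longleftrightarrow> (\<forall>L. \<exists>C. \<forall>a\<in>A. \<forall>b\<in>A. a < b \<and> b < a + L \<longrightarrow> b < C)"

lemma gaps_to_infinity_powers_of_2: "gaps_to_infinity (range (\<lambda>k. 2 ^ k))"
  unfolding gaps_to_infinity_def
proof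
  fix L :: nat
  have "b < 2 * L" if a: "a \<in> range (\<lambda>k. 2 ^ k)" and b: "b \<in> range (\<lambda>k. 2 ^ k)"
    and ab: "a < b" "b < a + L" for a b :: nat
  proof -
    obtain i j where ij: "a = 2 ^ i" "b = 2 ^ j" using a b by blast
    have "i < j" using ab ij by simp
    then obtain m where m: "j = Suc m" "i \<le> m" by (cases j) auto
    have "a \<le> 2 ^ m" "b = 2 * 2 ^ m" using ij m by simp_all
    then show ?thesis using ab by linarith
  qed
  then show "\<exists>C. \<forall>a\<in>range (\<lambda>k. 2 ^ k). \<forall>b\<in>range (\<lambda>k. 2 ^ k). a < b \<and> b < a + L \<longrightarrow> b < (C::nat)"
    by blast
qed

text \<open>If all differences of \<open>D\<close> of size at least \<open>K\<close> were \<open>K\<close>-close to \<open>A\<close>, then for every large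
  \<open>e \<in> D\<close> the numbers \<open>e - d0\<close> and \<open>e - d1\<close> would have neighbours in \<open>A\<close>. These are distinct as soon
  as \<open>d1 - d0\<close> exceeds \<open>2 * K\<close>, and their distance is bounded independently of \<open>e\<close>, so the gaps of
  \<open>A\<close> do not tend to infinity.\<close>

lemma difference_far_from_set_with_gaps:
  assumes A: "gaps_to_infinity A" and D: "infinite D"
  obtains d d' where "d \<in> D" "d' \<in> D" "d < d'" "K \<le> d' - d"
    "\<And>a. a \<in> A \<Longrightarrow> int K \<le> \<bar>int a - int (d' - d)\<bar>"
proof -
  have "\<exists>d\<in>D. \<exists>d'\<in>D. d < d' \<and> K \<le> d' - d \<and> (\<forall>a\<in>A. int K \<le> \<bar>int a - int (d' - d)\<bar>)"
  proof (rule ccontr)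
    assume "\<not> ?thesis"
    then have near: "\<exists>a\<in>A. \<bar>int a - int (d' - d)\<bar> < int K"
      if "d \<in> D" "d' \<in> D" "d < d'" "K \<le> d' - d" for d d'
      using that by (meson not_le)
    have unbounded: "\<exists>e\<in>D. m < e" for m using D by (meson infinite_nat_iff_unbounded)
    obtain d0 where d0: "d0 \<in> D" using unbounded by blast
    obtain d1 where d1: "d1 \<in> D" "d0 + 2 * K < d1" using unbounded by blast
    obtain C where C: "\<And>a b. \<lbrakk>a \<in> A; b \<in> A; a < b; b < a + (d1 - d0 + 2 * K)\<rbrakk> \<Longrightarrow> b < C"
      using A unfolding gaps_to_infinity_def by meson
    obtain e where e: "e \<in> D" "d1 + C + 2 * K < e" using unbounded by blast
    obtain a where a: "a \<in> A" "\<bar>int a - int (e - d0)\<bar> < int K"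
      using near[of d0 e] d0 d1 e by force
    obtain b where b: "b \<in> A" "\<bar>int b - int (e - d1)\<bar> < int K"
      using near[of d1 e] d1 e by force
    have "b < a" "a < b + (d1 - d0 + 2 * K)" "C < a" using a(2) b(2) d1(2) e(2) by linarith+
    then show False using C[OF b(1) a(1)] by simp
  qed
  then show thesis using that by blast
qed

section \<open>The rainbow-free subshift\<close>

text \<open>The common value of \<open>p - a\<close>, \<open>q - b\<close>, \<open>r - c\<close> is the amount by which \<open>A\<close> is translated. It
  ranges over all integers because gluing copies a word to a later time \<open>n\<close>: the translate of \<open>A\<close>
  by some \<open>t < n\<close> meets this copy as the translate by \<open>t - n\<close>, which is negative, meets the
  original word.\<close>

definition rainbow_free :: "nat set \<Rightarrow> (nat \<Rightarrow> real) set" where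
  "rainbow_free A = {x. range x \<subseteq> {0, 1, 2, 3} \<and>
     (\<forall>p q r. \<forall>a\<in>A. \<forall>b\<in>A. \<forall>c\<in>A.
        int p - int a = int q - int b \<and> int q - int b = int r - int c \<longrightarrow>
        \<not> (x p = 1 \<and> x q = 2 \<and> x r = 3))}"

lemma rainbow_freeI:
  assumes "\<And>p. x p \<in> {0, 1, 2, 3}"
    and "\<And>p q r a b c. \<lbrakk>a \<in> A; b \<in> A; c \<in> A; x p = 1; x q = 2; x r = 3;
           int p - int a = int q - int b; int q - int b = int r - int c\<rbrakk> \<Longrightarrow> False"
  shows "x \<in> rainbow_free A"
  using assms unfolding rainbow_free_def by blast

lemma rainbow_free_symbol: "x \<in> rainbow_free A \<Longrightarrow> x p \<in> {0, 1, 2, 3}"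
  unfolding rainbow_free_def by blast

lemma rainbow_freeD:
  assumes "x \<in> rainbow_free A" "a \<in> A" "b \<in> A" "c \<in> A" "x p = 1" "x q = 2" "x r = 3"
    "int p - int a = int q - int b" "int q - int b = int r - int c"
  shows False
  using assms unfolding rainbow_free_def by blast

lemma zero_in_rainbow_free: "(\<lambda>_. 0) \<in> rainbow_free A"
  by (rule rainbow_freeI) auto

lemma single_symbol_in_rainbow_free:
  assumes "s \<in> {1, 2, 3}"
  shows "(\<lambda>i. if i = 0 then s else 0) \<in> rainbow_free A"
  by (rule rainbow_freeI) (use assms in \<open>auto split: if_splits\<close>)

lemma compact_rainbow_free: "compact (rainbow_free A)"
proof -
  \<comment> \<open>Inside the compact product \<open>?S\<close>, the negation of \<open>x p = 1\<close> is the closed condition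
    \<open>x p \<in> {0, 2, 3}\<close>, and similarly for \<open>2\<close> and \<open>3\<close>.\<close>
  let ?S = "{x :: nat \<Rightarrow> real. range x \<subseteq> {0, 1, 2, 3}}"
  let ?R = "\<lambda>(p, q, r). {x :: nat \<Rightarrow> real. x p \<in> {0, 2, 3}} \<union> {x. x q \<in> {0, 1, 3}} \<union> {x. x r \<in> {0, 1, 2}}"
  let ?I = "{(p, q, r). \<exists>a\<in>A. \<exists>b\<in>A. \<exists>c\<in>A.
              int p - int a = int q - int b \<and> int q - int b = int r - int c}"
  have "?S = PiE UNIV (\<lambda>_. {0, 1, 2, 3})" by (auto simp: PiE_def)
  moreover have "compactin (product_topology (\<lambda>_. euclidean) UNIV)
      (PiE (UNIV :: nat set) (\<lambda>_. {0, 1, 2, 3 :: real}))"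
    by (subst compactin_PiE) (auto intro: finite_imp_compact)
  ultimately have S: "compact ?S"
    by (simp add: euclidean_product_topology)
  have coord: "closed {x :: nat \<Rightarrow> real. x i \<in> F}" if "finite F" for i F
  proof -
    have "closed ((\<lambda>x. x i) -` F)"
      using closed_vimage[OF finite_imp_closed[OF that] continuous_on_product_coordinates] .
    then show ?thesis by (simp add: vimage_def)
  qed
  have R: "closed (?R i)" for i
    by (cases i) (auto simp del: insert_iff intro!: closed_Un coord)
  have "rainbow_free A = ?S \<inter> (\<Inter>i\<in>?I. ?R i)"
  proof (intro equalityI subsetI)
    fix x assume x: "x \<in> rainbow_free A"
    have "x \<in> ?R (p, q, r)" if "(p, q, r) \<in> ?I" for p q r
      using that rainbow_freeD[OF x, of _ _ _ p q r]
        rainbow_free_symbol[OF x, of p] rainbow_free_symbol[OF x, of q] rainbow_free_symbol[OF x, of r]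
      by auto
    moreover have "x \<in> ?S" using rainbow_free_symbol[OF x] by blast
    ultimately show "x \<in> ?S \<inter> (\<Inter>i\<in>?I. ?R i)" by blast
  next
    fix x assume x: "x \<in> ?S \<inter> (\<Inter>i\<in>?I. ?R i)"
    show "x \<in> rainbow_free A"
    proof (rule rainbow_freeI)
      show "x p \<in> {0, 1, 2, 3}" for p using x by blast
      fix p q r a b c
      assume *: "a \<in> A" "b \<in> A" "c \<in> A" "x p = 1" "x q = 2" "x r = 3"
        "int p - int a = int q - int b" "int q - int b = int r - int c"
      then have "(p, q, r) \<in> ?I" by blast
      then have "x \<in> ?R (p, q, r)" using x by blast
      then show False using * by simp
    qed
  qed
  moreover have "closed (\<Inter>i\<in>?I. ?R i)" using R by (intro closed_INT) blast
  ultimately show ?thesis using S by (simp add: compact_Int_closed)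
qed

abbreviation shift :: "(nat \<Rightarrow> real) \<Rightarrow> nat \<Rightarrow> real" where
  "shift x \<equiv> (\<lambda>i. x (Suc i))"

lemma funpow_shift: "(shift ^^ n) x = (\<lambda>i. x (n + i))"
  by (induction n arbitrary: x) (simp_all add: funpow_swap1)

lemma shift_image_rainbow_free: "shift ` rainbow_free A = rainbow_free A"
proof (intro equalityI subsetI)
  fix y assume "y \<in> shift ` rainbow_free A"
  then obtain x where x: "x \<in> rainbow_free A" and y: "y = shift x" by blast
  show "y \<in> rainbow_free A"
  proof (rule rainbow_freeI)
    show "y p \<in> {0, 1, 2, 3}" for p using rainbow_free_symbol[OF x] y by simp
    show False if "a \<in> A" "b \<in> A" "c \<in> A" "y p = 1" "y q = 2" "y r = 3"
      "int p - int a = int q - int b" "int q - int b = int r - int c" for p q r a b c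
      using rainbow_freeD[OF x, of a b c "Suc p" "Suc q" "Suc r"] that y by simp
  qed
next
  fix x assume x: "x \<in> rainbow_free A"
  \<comment> \<open>The neutral symbol in front cannot take part in a rainbow.\<close>
  let ?y = "\<lambda>i. case i of 0 \<Rightarrow> 0 | Suc j \<Rightarrow> x j"
  have "?y \<in> rainbow_free A"
  proof (rule rainbow_freeI)
    show "?y p \<in> {0, 1, 2, 3}" for p using rainbow_free_symbol[OF x] by (cases p) auto
    fix p q r a b c
    assume *: "a \<in> A" "b \<in> A" "c \<in> A" "?y p = 1" "?y q = 2" "?y r = 3"
      "int p - int a = int q - int b" "int q - int b = int r - int c"
    then obtain p' q' r' where "p = Suc p'" "q = Suc q'" "r = Suc r'"
      by (cases p; cases q; cases r) auto
    then show False using rainbow_freeD[OF x, of a b c p' q' r'] * by simp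
  qed
  moreover have "x = shift ?y" by simp
  ultimately show "x \<in> shift ` rainbow_free A" by blast
qed

section \<open>Gluing words\<close>

text \<open>A rainbow within one of the two blocks is a rainbow of \<open>x\<close> or of \<open>y\<close>. Otherwise two of its
  positions share a block. Their indices in \<open>A\<close> are less than \<open>L\<close> apart, hence below \<open>C\<close>, and
  the index of the third position is then either closer to \<open>n\<close> than \<open>L + C\<close> (second block) or
  negative because \<open>n \<ge> L + C\<close> (first block).\<close>

lemma glue_in_rainbow_free:
  assumes x: "x \<in> rainbow_free A" and y: "y \<in> rainbow_free A"
    and C: "\<And>a b. \<lbrakk>a \<in> A; b \<in> A; a < b; b < a + L\<rbrakk> \<Longrightarrow> b < C"
    and n: "L + C \<le> n" and far: "\<And>a. a \<in> A \<Longrightarrow> int (L + C) \<le> \<bar>int a - int n\<bar>"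
  shows "(\<lambda>i. if i < L then x i else if n \<le> i \<and> i < n + L then y (i - n) else 0) \<in> rainbow_free A"
    (is "?z \<in> _")
proof (rule rainbow_freeI)
  show "?z p \<in> {0, 1, 2, 3}" for p
    using rainbow_free_symbol[OF x, of p] rainbow_free_symbol[OF y, of "p - n"] by simp
  fix p q r a b c
  assume A: "a \<in> A" "b \<in> A" "c \<in> A" and z: "?z p = 1" "?z q = 2" "?z r = 3"
    and eq: "int p - int a = int q - int b" "int q - int b = int r - int c"
  have supp: "i < L \<or> n \<le> i \<and> i < n + L" if "?z i \<noteq> 0" for i
    using that by (auto split: if_splits)
  have close: "int a' < int C \<and> int b' < int C"
    if "a' \<in> A" "b' \<in> A" "a' \<noteq> b'" "\<bar>int a' - int b'\<bar> < int L" for a' b'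
    using C[of a' b'] C[of b' a'] that by linarith
  \<comment> \<open>Stated without mention of the colours, so that it applies to each choice of the two
    positions that share a block.\<close>
  have split: False
    if "a' \<in> A" "b' \<in> A" "c' \<in> A" "p' \<noteq> q'"
      "int p' - int a' = int q' - int b'" "int q' - int b' = int r' - int c'"
      "p' < L \<and> q' < L \<and> n \<le> r' \<and> r' < n + L \<or>
       n \<le> p' \<and> p' < n + L \<and> n \<le> q' \<and> q' < n + L \<and> r' < L" for a' b' c' p' q' r'
  proof -
    have "a' \<noteq> b'" "\<bar>int a' - int b'\<bar> < int L" using that by linarith+
    then have "int a' < int C" using close that by blast
    moreover have "int (L + C) \<le> \<bar>int c' - int n\<bar>" using far that by blast
    ultimately show False using that n by linarith
  qed
  have ne: "p \<noteq> q" "q \<noteq> r" "p \<noteq> r" using z by auto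
  have eq': "int r - int c = int p - int a" using eq by simp
  have eq'': "int p - int a = int r - int c" "int r - int c = int q - int b" using eq by simp_all
  have "p < L \<and> q < L \<and> r < L \<or> n \<le> p \<and> p < n + L \<and> n \<le> q \<and> q < n + L \<and> n \<le> r \<and> r < n + L"
    using split[OF A ne(1) eq] split[OF A(2,3,1) ne(2) eq(2) eq'] split[OF A(1,3,2) ne(3) eq'']
      supp[of p] supp[of q] supp[of r] z by auto
  then show False
  proof
    assume "p < L \<and> q < L \<and> r < L"
    then show False using rainbow_freeD[OF x A, of p q r] z eq by simp
  next
    assume *: "n \<le> p \<and> p < n + L \<and> n \<le> q \<and> q < n + L \<and> n \<le> r \<and> r < n + L"
    then have "int (p - n) - int a = int (q - n) - int b" "int (q - n) - int b = int (r - n) - int c"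
      using eq by linarith+
    moreover have "y (p - n) = 1" "y (q - n) = 2" "y (r - n) = 3" using * z n by auto
    ultimately show False using rainbow_freeD[OF y A] by blast
  qed
qed

text \<open>The constant depends on the length \<open>L\<close> but not on the two words, so one time \<open>n\<close> can be used in
  both factors of the Cartesian square.\<close>

lemma glue_eventually_in_rainbow_free:
  assumes A: "gaps_to_infinity A"
  obtains K where "\<And>n x y. \<lbrakk>K \<le> n; \<And>a. a \<in> A \<Longrightarrow> int K \<le> \<bar>int a - int n\<bar>;
      x \<in> rainbow_free A; y \<in> rainbow_free A\<rbrakk> \<Longrightarrow>
      \<exists>z\<in>rainbow_free A. (\<forall>i<L. z i = x i) \<and> (\<forall>i<L. z (n + i) = y i)"
proof -
  obtain C where C: "\<And>a b. \<lbrakk>a \<in> A; b \<in> A; a < b; b < a + L\<rbrakk> \<Longrightarrow> b < C"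
    using A unfolding gaps_to_infinity_def by meson
  show thesis
  proof (rule that)
    fix n x y
    assume n: "L + C \<le> n" "\<And>a. a \<in> A \<Longrightarrow> int (L + C) \<le> \<bar>int a - int n\<bar>"
      and xy: "x \<in> rainbow_free A" "y \<in> rainbow_free A"
    show "\<exists>z\<in>rainbow_free A. (\<forall>i<L. z i = x i) \<and> (\<forall>i<L. z (n + i) = y i)"
      by (rule bexI[OF _ glue_in_rainbow_free[OF xy C n]]) (use n(1) in auto)
  qed
qed

section \<open>The dynamical system\<close>

lemma openin_contains_cylinder:
  fixes M :: "(nat \<Rightarrow> real) set"
  assumes "openin (top_of_set M) U" "x \<in> U"
  obtains L where "\<And>y. \<lbrakk>y \<in> M; \<forall>i<L. y i = x i\<rbrakk> \<Longrightarrow> y \<in> U"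
proof -
  obtain W where W: "open W" "U = M \<inter> W" using assms(1) by (auto simp: openin_open)
  have "openin (product_topology (\<lambda>_. euclidean) UNIV) W"
    using W(1) by (simp add: euclidean_product_topology)
  then obtain B where B: "x \<in> PiE UNIV B" "finite {i. B i \<noteq> UNIV}" "PiE UNIV B \<subseteq> W"
    using product_topology_open_contains_basis[of "\<lambda>_::nat. euclidean :: real topology" UNIV W x]
      assms(2) W(2) by auto
  obtain L where L: "\<And>i. B i \<noteq> UNIV \<Longrightarrow> i < L"
    using B(2) by (meson finite_nat_set_iff_bounded mem_Collect_eq)
  have "y \<in> U" if "y \<in> M" "\<forall>i<L. y i = x i" for y
  proof -
    have "y i \<in> B i" for i using B(1) L[of i] that(2) by (cases "i < L") (auto simp: PiE_iff)
    then show ?thesis using B(3) W(2) that(1) by (auto simp: PiE_iff)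
  qed
  then show thesis using that by blast
qed

lemma openin_prod_contains_cylinders:
  fixes M :: "(nat \<Rightarrow> real) set"
  assumes W: "openin (prod_topology (top_of_set M) (top_of_set M)) W" "W \<noteq> {}"
  obtains x x' L where "x \<in> M" "x' \<in> M"
    "\<And>z z'. \<lbrakk>z \<in> M; z' \<in> M; \<forall>i<L. z i = x i; \<forall>i<L. z' i = x' i\<rbrakk> \<Longrightarrow> (z, z') \<in> W"
proof -
  obtain x x' where "(x, x') \<in> W" using W(2) by auto
  then obtain G H where GH: "openin (top_of_set M) G" "openin (top_of_set M) H"
      "x \<in> G" "x' \<in> H" "G \<times> H \<subseteq> W"
    using W(1) unfolding openin_prod_topology_alt by meson
  obtain L where L: "\<And>y. \<lbrakk>y \<in> M; \<forall>i<L. y i = x i\<rbrakk> \<Longrightarrow> y \<in> G"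
    by (rule openin_contains_cylinder[OF GH(1,3)]) blast
  obtain L' where L': "\<And>y. \<lbrakk>y \<in> M; \<forall>i<L'. y i = x' i\<rbrakk> \<Longrightarrow> y \<in> H"
    by (rule openin_contains_cylinder[OF GH(2,4)]) blast
  show thesis
  proof (rule that)
    show "x \<in> M" "x' \<in> M" using GH openin_imp_subset by blast+
    fix z z'
    assume "z \<in> M" "z' \<in> M" "\<forall>i<max L L'. z i = x i" "\<forall>i<max L L'. z' i = x' i"
    then have "z \<in> G" "z' \<in> H" using L L' by simp_all
    then show "(z, z') \<in> W" using GH(5) by blast
  qed
qed

lemma mtopology_dist: "Metric_space.mtopology M dist = top_of_set M" for M :: "'a::metric_space set"
proof -
  interpret Submetric UNIV dist M by unfold_locales auto
  show ?thesis using mtopology_submetric by simp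
qed

lemma tds_rainbow_free: "tds (rainbow_free A) dist shift"
proof -
  interpret Submetric UNIV dist "rainbow_free A" by unfold_locales auto
  have "continuous_on (rainbow_free A) shift"
    by (intro continuous_on_coordinatewise_then_product
        continuous_on_subset[OF continuous_on_product_coordinates]) simp
  then have "continuous_map (top_of_set (rainbow_free A)) (top_of_set (rainbow_free A)) shift"
    using shift_image_rainbow_free[of A] by (auto simp: continuous_map_in_subtopology)
  then show ?thesis
    unfolding tds_def mtopology_dist
    using sub.Metric_space_axioms zero_in_rainbow_free[of A] compact_rainbow_free[of A] shift_image_rainbow_free[of A]
    by (auto simp: compact_space_subtopology)
qed

section \<open>Mixing but not full-scattering\<close>

lemma Delta_star_mixing_rainbow_free:
  assumes A: "gaps_to_infinity A"
  shows "Delta_star_mixing (top_of_set (rainbow_free A)) shift"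
  unfolding Delta_star_mixing_def Delta_star_transitive_def
proof (intro allI impI)
  let ?X = "top_of_set (rainbow_free A)"
  let ?P = "prod_topology ?X ?X"
  let ?T = "map_prod shift shift"
  fix U V
  assume UV: "openin ?P U \<and> U \<noteq> {} \<and> openin ?P V \<and> V \<noteq> {}"
  then have nonempty: "openin ?P U" "U \<noteq> {}" "openin ?P V" "V \<noteq> {}" by simp_all
  obtain x x' L1 where x: "x \<in> rainbow_free A" "x' \<in> rainbow_free A"
    and U: "\<And>z z'. \<lbrakk>z \<in> rainbow_free A; z' \<in> rainbow_free A;
      \<forall>i<L1. z i = x i; \<forall>i<L1. z' i = x' i\<rbrakk> \<Longrightarrow> (z, z') \<in> U"
    by (rule openin_prod_contains_cylinders[OF nonempty(1,2)]) blast
  obtain y y' L2 where y: "y \<in> rainbow_free A" "y' \<in> rainbow_free A"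
    and V: "\<And>z z'. \<lbrakk>z \<in> rainbow_free A; z' \<in> rainbow_free A;
      \<forall>i<L2. z i = y i; \<forall>i<L2. z' i = y' i\<rbrakk> \<Longrightarrow> (z, z') \<in> V"
    by (rule openin_prod_contains_cylinders[OF nonempty(3,4)]) blast
  let ?L = "max L1 L2"
  obtain K where glue: "\<And>n u v. \<lbrakk>K \<le> n; \<And>a. a \<in> A \<Longrightarrow> int K \<le> \<bar>int a - int n\<bar>;
      u \<in> rainbow_free A; v \<in> rainbow_free A\<rbrakk> \<Longrightarrow>
      \<exists>z\<in>rainbow_free A. (\<forall>i<?L. z i = u i) \<and> (\<forall>i<?L. z (n + i) = v i)"
    by (rule glue_eventually_in_rainbow_free[OF A, of ?L]) blast
  have hit: "n \<in> hitting_times ?P ?T U V"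
    if n: "K \<le> n" "\<And>a. a \<in> A \<Longrightarrow> int K \<le> \<bar>int a - int n\<bar>" for n
  proof -
    obtain z where z: "z \<in> rainbow_free A" "\<forall>i<?L. z i = x i" "\<forall>i<?L. z (n + i) = y i"
      using glue[OF n x(1) y(1)] by blast
    obtain z' where z': "z' \<in> rainbow_free A" "\<forall>i<?L. z' i = x' i" "\<forall>i<?L. z' (n + i) = y' i"
      using glue[OF n x(2) y(2)] by blast
    have iter: "(?T ^^ n) (u, v) = ((shift ^^ n) u, (shift ^^ n) v)" for u v
      by (induction n) simp_all
    have inv: "(shift ^^ n) u \<in> rainbow_free A" if "u \<in> rainbow_free A" for u
      using that shift_image_rainbow_free[of A] by (induction n) auto
    have "(z, z') \<in> U" using U z z' by simp
    moreover have "((shift ^^ n) z, (shift ^^ n) z') \<in> V"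
      using V[OF inv[OF z(1)] inv[OF z'(1)]] z z' by (simp add: funpow_shift)
    ultimately show ?thesis
      using z(1) z'(1) unfolding hitting_times_def iter_preimage_def by (auto simp: iter)
  qed
  show "hitting_times ?P ?T U V \<in> Delta_star"
    unfolding Delta_star_def Delta_family_def
  proof (intro CollectI ballI)
    fix F :: "nat set" assume "F \<in> {F. \<exists>D. infinite D \<and> {d' - d | d d'. d \<in> D \<and> d' \<in> D \<and> d < d'} \<subseteq> F}"
    then obtain D where D: "infinite D" "{d' - d | d d'. d \<in> D \<and> d' \<in> D \<and> d < d'} \<subseteq> F" by blast
    obtain d d' where d: "d \<in> D" "d' \<in> D" "d < d'" "K \<le> d' - d"
      "\<And>a. a \<in> A \<Longrightarrow> int K \<le> \<bar>int a - int (d' - d)\<bar>"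
      by (rule difference_far_from_set_with_gaps[OF A D(1), of K]) blast
    then have "d' - d \<in> F" using D(2) by blast
    then show "hitting_times ?P ?T U V \<inter> F \<noteq> {}" using hit[of "d' - d"] d by blast
  qed
qed

text \<open>Along \<open>A\<close>, untranslated, each point misses one of the colours \<open>1, 2, 3\<close>. So the three constant
  itineraries of the cover by \<open>{x. x 0 \<noteq> s}\<close> already account for all points.\<close>

lemma not_full_scattering_rainbow_free:
  assumes A: "infinite A"
  shows "\<not> full_scattering (top_of_set (rainbow_free A)) shift"
proof -
  let ?M = "rainbow_free A"
  let ?X = "top_of_set ?M"
  let ?U = "\<lambda>s. {x \<in> ?M. x 0 \<noteq> s}"
  let ?cover = "?U ` {1, 2, 3}"
  have coord: "open {x :: nat \<Rightarrow> real. x 0 \<in> B}" if "open B" for B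
    using open_vimage[OF that continuous_on_product_coordinates[of 0]]
    by (simp add: vimage_def)
  have openU: "openin ?X (?U s)" for s
  proof -
    have "?U s = ?M \<inter> {x. x 0 \<in> - {s}}" by auto
    then show ?thesis using openin_open_Int[OF coord[of "- {s}"]] by auto
  qed
  have "?X closure_of ?U s \<noteq> ?M" if s: "s \<in> {1, 2, 3}" for s
  proof -
    let ?x = "\<lambda>i::nat. if i = 0 then s else 0"
    \<comment> \<open>Distinct symbols are at distance at least \<open>1\<close>, so this open set is the cylinder of \<open>s\<close>.\<close>
    let ?B = "?M \<inter> {x. x 0 \<in> ball s 1}"
    have "x 0 = s" if "x \<in> ?B" for x
    proof -
      have "x 0 \<in> {0, 1, 2, 3}" "dist s (x 0) < 1" using that rainbow_free_symbol by auto
      then show ?thesis using s by (auto simp: dist_real_def)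
    qed
    then have disj: "?B \<inter> ?U s = {}" by blast
    have B: "openin ?X ?B" using openin_open_Int[OF coord[OF open_ball]] .
    have x: "?x \<in> ?M" "?x \<in> ?B"
      using single_symbol_in_rainbow_free[OF s, of A] by simp_all
    have "?x \<notin> ?X closure_of ?U s"
    proof
      assume "?x \<in> ?X closure_of ?U s"
      then have "\<forall>T. ?x \<in> T \<and> openin ?X T \<longrightarrow> (\<exists>y. y \<in> ?U s \<and> y \<in> T)"
        unfolding in_closure_of by (rule conjunct2)
      from this[rule_format, OF conjI[OF x(2) B]] show False using disj by blast
    qed
    then show ?thesis using x(1) by blast
  qed
  moreover have "is_cover ?M ?cover" unfolding is_cover_def by auto
  ultimately have nontrivial: "nontrivial_open_cover ?X ?cover"
    unfolding nontrivial_open_cover_def using openU by auto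
  have bound: "cover_complexity ?X shift A ?cover n \<le> 3" for n
  proof -
    let ?a = "enumerate A"
    define W where "W = (\<lambda>s. ?M \<inter> (\<Inter>i<n. iter_preimage ?X shift (?a i) (?U s)))"
    let ?J = "cover_join ?M n (\<lambda>i. iter_preimage ?X shift (?a i) ` ?cover)"
    have sub: "W ` {1, 2, 3} \<subseteq> ?J"
    proof (rule image_subsetI)
      fix s :: real assume "s \<in> {1, 2, 3}"
      then show "W s \<in> ?J"
        unfolding cover_join_def W_def
        by (intro CollectI exI[of _ "\<lambda>i. iter_preimage ?X shift (?a i) (?U s)"] conjI refl allI impI imageI)
    qed
    have "\<exists>s\<in>{1, 2, 3}. x \<in> W s" if x: "x \<in> ?M" for x
    proof (rule ccontr)
      assume no: "\<not> ?thesis"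
      have inv: "(shift ^^ m) x \<in> ?M" for m
        using x shift_image_rainbow_free[of A] by (induction m) auto
      have visit: "\<exists>a\<in>A. x a = s" if "s \<in> {1, 2, 3}" for s
      proof -
        have "\<exists>i<n. x (?a i) = s"
          using no x inv that unfolding W_def iter_preimage_def by (auto simp: funpow_shift)
        then show ?thesis using enumerate_in_set[OF A] by blast
      qed
      obtain a b c where "a \<in> A" "x a = 1" "b \<in> A" "x b = 2" "c \<in> A" "x c = 3"
        using visit[of 1] visit[of 2] visit[of 3] by blast
      then show False using rainbow_freeD[OF x, of a b c a b c] by simp
    qed
    moreover have "W s \<subseteq> ?M" for s unfolding W_def by simp
    ultimately have cov: "is_cover ?M (W ` {1, 2, 3})" unfolding is_cover_def by blast
    have "min_subcover_card ?M ?J \<le> card (W ` {1, 2, 3})"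
      unfolding min_subcover_card_def
      by (rule Least_le, rule exI[of _ "W ` {1, 2, 3}"]) (use sub cov in simp)
    also have "\<dots> \<le> card {1, 2, 3 :: real}" by (rule card_image_le) simp
    finally show ?thesis unfolding cover_complexity_def by simp
  qed
  show ?thesis
  proof
    assume "full_scattering ?X shift"
    then have "filterlim (cover_complexity ?X shift A ?cover) at_top sequentially"
      using A nontrivial unfolding full_scattering_def by blast
    then have "\<forall>\<^sub>F n in sequentially. 4 \<le> cover_complexity ?X shift A ?cover n"
      by (simp add: filterlim_at_top)
    then obtain n where "4 \<le> cover_complexity ?X shift A ?cover n"
      by (meson eventually_sequentially order_refl)
    then show False using bound[of n] by simp
  qed
qed

theorem theorem1p2:
  "\<exists>(M :: (nat \<Rightarrow> real) set) (d :: (nat \<Rightarrow> real) \<Rightarrow> (nat \<Rightarrow> real) \<Rightarrow> real)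
      (T :: (nat \<Rightarrow> real) \<Rightarrow> (nat \<Rightarrow> real)).
     tds M d T \<and>
     Delta_star_mixing (Metric_space.mtopology M d) T \<and>
     \<not> full_scattering (Metric_space.mtopology M d) T"
proof (intro exI conjI)
  let ?A = "range (\<lambda>k. 2 ^ k) :: nat set"
  have "inj (\<lambda>k. 2 ^ k :: nat)" by (rule injI) simp
  then have "infinite ?A" by (rule range_inj_infinite)
  then show "\<not> full_scattering (Metric_space.mtopology (rainbow_free ?A) dist) shift"
    using not_full_scattering_rainbow_free by (simp add: mtopology_dist)
  show "tds (rainbow_free ?A) dist shift" by (rule tds_rainbow_free)
  show "Delta_star_mixing (Metric_space.mtopology (rainbow_free ?A) dist) shift"
    using Delta_star_mixing_rainbow_free[OF gaps_to_infinity_powers_of_2] by (simp add: mtopology_dist)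
qed

end
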